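(* Let $\vec\mu=\mu_1\times\mu_2$ and $\vec\nu=\nu_1\times\nu_2$ be positive measures on the space $X\times X$ and, for $i\in\{1,2\}$, let $K_i$ be a nonnegative function on $X\times X$. Let $T$ be the integral operator defined by, for any $(x,y)\in X\times X$, $$Tf(x,y):=\int_X\int_X K_1(x,s)K_2(y,t)f(s,t)\,d\mu_1(s)\,d\mu_2(t).$$ Suppose $\vec p=(p_1,p_2),\vec q=(q_1,q_2)\in(1,\infty)^2$ satisfy $1<p_-\le p_+\le q_-<\infty$, where $p_+:=\max\{p_1,p_2\}$, $p_-:=\min\{p_1,p_2\}$, $q_-:=\min\{q_1,q_2\}$. Let $\gamma_i,\delta_i$ be real numbers with $\gamma_i+\delta_i=1$ for $i\in\{1,2\}$. If there exist two positive functions $h_1,h_2$ on $X\times X$ and two positive constants $C_1,C_2$ such that for almost all $(x,y)\in X\times X$, $$\int_X\Big[\int_X [K_1(x,s)]^{\gamma_1p_1'}[K_2(y,t)]^{\gamma_2p_1'}[h_1(s,t)]^{p_1'}\,d\mu_1(s)\Big]^{p_2'/p_1'}d\mu_2(t)\le C_1[h_2(x,y)]^{p_2'}$$ and for almost all $(s,t)\in X\times X$, $$\int_X\Big[\int_X [K_1(x,s)]^{\delta_1q_1}[K_2(y,t)]^{\delta_2q_1}[h_2(x,y)]^{q_1}\,d\nu_1(x)\Big]^{q_2/q_1}d\nu_2(y)\le C_2[h_1(s,t)]^{q_2},$$ then $T:L^{\vec p}_{\vec\mu}\to L^{\vec q}_{\vec\nu}$ is bounded with $\|T\|_{L^{\vec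 p}_{\vec\mu}\to L^{\vec q}_{\vec\nu}}\le C_1^{1/p_2'}C_2^{1/q_2}$.
   Context: For $q\in[1,\infty]$, $q'$ is the Hölder conjugate exponent, $1/q+1/q'=1$. For $\vec p=(p_1,p_2)\in[1,\infty)^2$ and a product measure $\vec\mu=\mu_1\times\mu_2$ on $X\times X$, $L^{\vec p}_{\vec\mu}$ is the mixed-norm Lebesgue space of measurable $f$ on $X\times X$ with $$\|f\|_{L^{\vec p}_{\vec\mu}}=\Big\{\int_X\Big[\int_X|f(s,t)|^{p_1}\,d\mu_1(s)\Big]^{p_2/p_1}d\mu_2(t)\Big\}^{1/p_2}<\infty.$$ *)

theory Defs
  imports "HOL-Analysis.Analysis"
begin

text \<open>
  Real powers on \<open>[0, \<infinity>]\<close>. The library's real \<open>powr\<close> has \<open>0 powr a = 0\<close> for every \<open>a\<close>; here the usual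
  conventions hold instead: \<open>0\<close> to the power \<open>0\<close> is \<open>1\<close>, and \<open>0\<close> to a negative power is \<open>\<infinity>\<close>
  (the exponents of the kernels may be zero or negative). Products follow \<^typ>\<open>ennreal\<close>, so \<open>0 * \<infinity> = 0\<close>.
\<close>
definition epowr :: "ennreal \<Rightarrow> real \<Rightarrow> ennreal" (infixr "epowr" 80) where
  "x epowr a =
     (if a = 0 then 1
      else if x = 0 then (if a > 0 then 0 else \<infinity>)
      else if x = \<infinity> then (if a > 0 then \<infinity> else 0)
      else ennreal (enn2real x powr a))"

definition mixed_norm ::
  "real \<Rightarrow> real \<Rightarrow> 'a measure \<Rightarrow> 'a measure \<Rightarrow> ('a \<times> 'a \<Rightarrow> complex) \<Rightarrow> ennreal" where
  "mixed_norm p1 p2 \<mu>1 \<mu>2 f =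
     (\<integral>\<^sup>+ t. (\<integral>\<^sup>+ s. ennreal (norm (f (s, t))) epowr p1 \<partial>\<mu>1) epowr (p2 / p1) \<partial>\<mu>2) epowr (1 / p2)"

definition mixed_Lp ::
  "real \<Rightarrow> real \<Rightarrow> 'a measure \<Rightarrow> 'a measure \<Rightarrow> ('a \<times> 'a \<Rightarrow> complex) set" where
  "mixed_Lp p1 p2 \<mu>1 \<mu>2 =
     {f \<in> borel_measurable (\<mu>1 \<Otimes>\<^sub>M \<mu>2). mixed_norm p1 p2 \<mu>1 \<mu>2 f < \<infinity>}"

definition product_kernel_op ::
  "('a \<times> 'a \<Rightarrow> real) \<Rightarrow> ('a \<times> 'a \<Rightarrow> real) \<Rightarrow> 'a measure \<Rightarrow> 'a measure \<Rightarrow>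
     ('a \<times> 'a \<Rightarrow> complex) \<Rightarrow> 'a \<times> 'a \<Rightarrow> complex" where
  "product_kernel_op K1 K2 \<mu>1 \<mu>2 f = (\<lambda>(x, y).
     \<integral>t. (\<integral>s. complex_of_real (K1 (x, s) * K2 (y, t)) * f (s, t) \<partial>\<mu>1) \<partial>\<mu>2)"

text \<open>
  The Bochner integral of a non-integrable function is \<open>0\<close>, so that the integral defining the
  operator converges absolutely at \<open>(x, y)\<close> has to be stated separately.
\<close>
definition product_kernel_converges ::
  "('a \<times> 'a \<Rightarrow> real) \<Rightarrow> ('a \<times> 'a \<Rightarrow> real) \<Rightarrow> 'a measure \<Rightarrow> 'a measure \<Rightarrow>
     ('a \<times> 'a \<Rightarrow> complex) \<Rightarrow> 'a \<times> 'a \<Rightarrow> bool" where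
  "product_kernel_converges K1 K2 \<mu>1 \<mu>2 f = (\<lambda>(x, y).
     integrable (\<mu>1 \<Otimes>\<^sub>M \<mu>2) (\<lambda>(s, t). complex_of_real (K1 (x, s) * K2 (y, t)) * f (s, t)))"

text \<open>
  Elements of the mixed-norm spaces are represented by functions, so linearity is required only
  almost everywhere. Together with the norm estimate it makes \<open>T\<close> respect almost-everywhere equality.
\<close>
definition bounded_mixed_op ::
  "real \<Rightarrow> real \<Rightarrow> 'a measure \<Rightarrow> 'a measure \<Rightarrow> real \<Rightarrow> real \<Rightarrow> 'a measure \<Rightarrow> 'a measure \<Rightarrow>
     (('a \<times> 'a \<Rightarrow> complex) \<Rightarrow> 'a \<times> 'a \<Rightarrow> complex) \<Rightarrow> bool" where
  "bounded_mixed_op p1 p2 \<mu>1 \<mu>2 q1 q2 \<nu>1 \<nu>2 T \<longleftrightarrow>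
     (\<forall>f \<in> mixed_Lp p1 p2 \<mu>1 \<mu>2. T f \<in> mixed_Lp q1 q2 \<nu>1 \<nu>2) \<and>
     (\<forall>f \<in> mixed_Lp p1 p2 \<mu>1 \<mu>2. \<forall>g \<in> mixed_Lp p1 p2 \<mu>1 \<mu>2.
        AE z in \<nu>1 \<Otimes>\<^sub>M \<nu>2. T (\<lambda>w. f w + g w) z = T f z + T g z) \<and>
     (\<forall>f \<in> mixed_Lp p1 p2 \<mu>1 \<mu>2. \<forall>c.
        AE z in \<nu>1 \<Otimes>\<^sub>M \<nu>2. T (\<lambda>w. c * f w) z = c * T f z) \<and>
     (\<exists>B::real. \<forall>f \<in> mixed_Lp p1 p2 \<mu>1 \<mu>2.
        mixed_norm q1 q2 \<nu>1 \<nu>2 (T f) \<le> ennreal B * mixed_norm p1 p2 \<mu>1 \<mu>2 f)"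

definition mixed_opnorm ::
  "real \<Rightarrow> real \<Rightarrow> 'a measure \<Rightarrow> 'a measure \<Rightarrow> real \<Rightarrow> real \<Rightarrow> 'a measure \<Rightarrow> 'a measure \<Rightarrow>
     (('a \<times> 'a \<Rightarrow> complex) \<Rightarrow> 'a \<times> 'a \<Rightarrow> complex) \<Rightarrow> ennreal" where
  "mixed_opnorm p1 p2 \<mu>1 \<mu>2 q1 q2 \<nu>1 \<nu>2 T =
     (SUP f \<in> {f \<in> mixed_Lp p1 p2 \<mu>1 \<mu>2. mixed_norm p1 p2 \<mu>1 \<mu>2 f \<le> 1}.
        mixed_norm q1 q2 \<nu>1 \<nu>2 (T f))"

end

theory Submission
  imports Defs
begin

text \<open>
  Write \<open>K = (K\<^sup>\<gamma> h\<^sub>1) \<cdot> (K\<^sup>\<delta> / h\<^sub>1)\<close> for \<open>K = K\<^sub>1 K\<^sub>2\<close>. Hoelder's inequality in \<open>s\<close> and then in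
  \<open>t\<close> together with the first test condition bounds \<open>|T f(x, y)|\<close> by \<open>C\<^sub>1\<close> to the power \<open>1/p\<^sub>2'\<close> times
  the mixed \<open>p\<close>-norm in \<open>(s, t)\<close> of \<open>h\<^sub>2(x, y) K\<^sup>\<delta> |f(s, t)| / h\<^sub>1(s, t)\<close>. Since both \<open>p\<^sub>i\<close> are at most
  both \<open>q\<^sub>j\<close>, four applications of Minkowski's integral inequality move the \<open>q\<close>-norms in \<open>(x, y)\<close>
  inside the \<open>p\<close>-norms, where the second test condition cancels \<open>h\<^sub>1\<close>.
\<close>

section \<open>Powers on the extended half-line\<close>

lemma zero_epowr [simp]: "a > 0 \<Longrightarrow> 0 epowr a = 0"
  by (simp add: epowr_def)

lemma one_epowr [simp]: "1 epowr a = 1"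
  by (simp add: epowr_def)

lemma top_epowr [simp]: "a > 0 \<Longrightarrow> top epowr a = top"
  by (simp add: epowr_def)

lemma epowr_zero [simp]: "x epowr 0 = 1"
  by (simp add: epowr_def)

lemma ennreal_epowr: "x > 0 \<Longrightarrow> ennreal x epowr a = ennreal (x powr a)"
  by (auto simp: epowr_def)

text \<open>Isolates the two values at which \<open>epowr\<close> is fixed by convention; on the
  third case it is the real \<open>powr\<close>.\<close>

lemma ennreal_zero_pos_top_cases [case_names zero top pos]:
  obtains "x = (0::ennreal)" | "x = top" | r where "0 < r" "x = ennreal r"
  by (cases x) (auto simp: less_le ennreal_eq_zero_iff[symmetric] simp del: ennreal_eq_zero_iff)

lemma epowr_eq_0_iff: "a > 0 \<Longrightarrow> x epowr a = 0 \<longleftrightarrow> x = 0"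
  by (cases x rule: ennreal_zero_pos_top_cases) (auto simp: ennreal_epowr)

lemma epowr_eq_top_iff: "a > 0 \<Longrightarrow> x epowr a = top \<longleftrightarrow> x = top"
  by (cases x rule: ennreal_zero_pos_top_cases) (auto simp: ennreal_epowr)

lemma epowr_one [simp]: "x epowr 1 = x"
  by (cases x rule: ennreal_zero_pos_top_cases) (auto simp: ennreal_epowr)

lemma epowr_mono:
  assumes "a \<ge> 0" "x \<le> y"
  shows "x epowr a \<le> y epowr a"
proof (cases "a = 0")
  case False
  then have "a > 0" using assms by simp
  with assms(2) show ?thesis
    by (cases x rule: ennreal_zero_pos_top_cases; cases y rule: ennreal_zero_pos_top_cases)
       (auto simp: ennreal_epowr top_unique intro: powr_mono2)
qed simp

text \<open>A negative exponent would break this at \<open>x = 0\<close>, \<open>y = top\<close>: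
  the left side becomes \<open>top\<close>, the right side \<open>top * 0 = 0\<close>.\<close>

lemma epowr_mult:
  assumes "a \<ge> 0"
  shows "(x * y) epowr a = x epowr a * y epowr a"
proof (cases "a = 0")
  case False
  then have "a > 0" using assms by simp
  then show ?thesis
    by (cases x rule: ennreal_zero_pos_top_cases; cases y rule: ennreal_zero_pos_top_cases)
       (auto simp: ennreal_epowr ennreal_mult[symmetric] ennreal_mult_top ennreal_top_mult powr_mult)
qed simp

text \<open>The conventions at 0 and \<open>top\<close> are consistent for all real exponents: a
  negative exponent swaps the two values, and signs multiply.\<close>

lemma epowr_epowr: "(x epowr a) epowr b = x epowr (a * b)"
proof (cases x rule: ennreal_zero_pos_top_cases)
  case (pos r)
  then show ?thesis by (simp add: ennreal_epowr powr_powr)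
qed (auto simp: epowr_def zero_less_mult_iff)

text \<open>At 0 and \<open>top\<close> opposite exponents would give \<open>0 * top = 0\<close>
  instead of 1. The uses below therefore treat these values separately.\<close>

lemma epowr_add: "x \<noteq> 0 \<Longrightarrow> x \<noteq> top \<Longrightarrow> x epowr (a + b) = x epowr a * x epowr b"
  by (cases x rule: ennreal_zero_pos_top_cases)
     (auto simp: ennreal_epowr ennreal_mult[symmetric] powr_add)

lemma borel_measurable_epowr [measurable (raw)]:
  assumes [measurable]: "f \<in> borel_measurable M"
  shows "(\<lambda>x. f x epowr a) \<in> borel_measurable M"
  unfolding epowr_def by measurable

text \<open>The power map is an order isomorphism with inverse exponent \<open>1 / a\<close>, so it
  commutes with arbitrary suprema, including the empty one.\<close>

lemma epowr_SUP:
  fixes u :: "'i \<Rightarrow> ennreal"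
  assumes "a > 0"
  shows "(SUP i\<in>I. u i) epowr a = (SUP i\<in>I. u i epowr a)"
proof (rule antisym)
  have "u i \<le> (SUP i\<in>I. u i epowr a) epowr (1 / a)" if "i \<in> I" for i
  proof -
    have "(u i epowr a) epowr (1 / a) \<le> (SUP i\<in>I. u i epowr a) epowr (1 / a)"
      using assms that by (intro epowr_mono SUP_upper) auto
    then show ?thesis using assms by (simp add: epowr_epowr)
  qed
  then have "(SUP i\<in>I. u i) \<le> (SUP i\<in>I. u i epowr a) epowr (1 / a)"
    by (rule SUP_least)
  from epowr_mono[OF _ this, of a] assms
  show "(SUP i\<in>I. u i) epowr a \<le> (SUP i\<in>I. u i epowr a)"
    by (simp add: epowr_epowr)
qed (use assms in \<open>auto intro!: SUP_least epowr_mono SUP_upper\<close>)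

section \<open>Young's inequality, norms of nonnegative functions, Hoelder's inequality\<close>

text \<open>Positive finite arguments reduce to the real inequality. If a factor is 0 the left side
  vanishes; if one is \<open>top\<close> the right side is \<open>top\<close>.\<close>

lemma ennreal_Young:
  fixes a b :: ennreal
  assumes "p > 1" "q > 1" "1 / p + 1 / q = 1"
  shows "a * b \<le> ennreal (1 / p) * a epowr p + ennreal (1 / q) * b epowr q"
proof -
  consider "a = 0 \<or> b = 0" | "a = top \<or> b = top" | r s where "0 < r" "a = ennreal r" "0 < s" "b = ennreal s"
    by (cases a rule: ennreal_zero_pos_top_cases; cases b rule: ennreal_zero_pos_top_cases) auto
  then show ?thesis
  proof cases
    case 2
    then show ?thesis using assms by (auto simp: ennreal_mult_top)
  next
    case 3
    then show ?thesis
      using Youngs_inequality[OF assms, of r s] assms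
      by (simp add: ennreal_epowr ennreal_mult[symmetric] ennreal_plus[symmetric] del: ennreal_plus)
  qed auto
qed

text \<open>Values are extended nonnegative reals, so norms can be nested without finiteness
  conditions; a mixed norm is then an \<open>Lnorm\<close> of an \<open>Lnorm\<close>.\<close>

definition Lnorm :: "real \<Rightarrow> 'a measure \<Rightarrow> ('a \<Rightarrow> ennreal) \<Rightarrow> ennreal" where
  "Lnorm p M f = (\<integral>\<^sup>+ x. f x epowr p \<partial>M) epowr (1 / p)"

lemma Lnorm_epowr: "p > 0 \<Longrightarrow> Lnorm p M f epowr p = (\<integral>\<^sup>+ x. f x epowr p \<partial>M)"
  by (simp add: Lnorm_def epowr_epowr)

lemma Lnorm_mono_AE: "p > 0 \<Longrightarrow> AE x in M. f x \<le> g x \<Longrightarrow> Lnorm p M f \<le> Lnorm p M g"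
  unfolding Lnorm_def by (auto intro!: epowr_mono nn_integral_mono_AE elim!: eventually_mono)

lemma Lnorm_mono: "p > 0 \<Longrightarrow> (\<And>x. x \<in> space M \<Longrightarrow> f x \<le> g x) \<Longrightarrow> Lnorm p M f \<le> Lnorm p M g"
  by (auto intro!: Lnorm_mono_AE)

lemma Lnorm_cong: "(\<And>x. x \<in> space M \<Longrightarrow> f x = g x) \<Longrightarrow> Lnorm p M f = Lnorm p M g"
  unfolding Lnorm_def by (simp cong: nn_integral_cong)

lemma Lnorm_cmult:
  assumes "p > 0" and [measurable]: "f \<in> borel_measurable M"
  shows "Lnorm p M (\<lambda>x. c * f x) = c * Lnorm p M f"
  using assms(1) unfolding Lnorm_def
  by (simp add: epowr_mult nn_integral_cmult epowr_epowr)

lemma (in sigma_finite_measure) borel_measurable_Lnorm [measurable (raw)]: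
  assumes [measurable]: "case_prod f \<in> borel_measurable (N \<Otimes>\<^sub>M M)"
  shows "(\<lambda>x. Lnorm p M (f x)) \<in> borel_measurable N"
  unfolding Lnorm_def by measurable

lemma Lnorm_eq_0_AE:
  assumes "p > 0" and [measurable]: "f \<in> borel_measurable M" and "Lnorm p M f = 0"
  shows "AE x in M. f x = 0"
  using assms(3) \<open>p > 0\<close> by (simp add: Lnorm_def epowr_eq_0_iff nn_integral_0_iff_AE)

lemma Lnorm_finite_AE:
  assumes "p > 0" and [measurable]: "f \<in> borel_measurable M" and "Lnorm p M f \<noteq> top"
  shows "AE x in M. f x \<noteq> top"
  using nn_integral_PInf_AE[of "\<lambda>x. f x epowr p" M] assms
  by (simp add: Lnorm_def epowr_eq_top_iff)

text \<open>Young's inequality is integrated after scaling both functions to norm 1. Norms equal to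
  0 or \<open>top\<close> cannot be scaled and are handled first.\<close>

lemma nn_integral_Holder:
  assumes pq: "p > 1" "q > 1" "1 / p + 1 / q = 1"
    and [measurable]: "f \<in> borel_measurable M" "g \<in> borel_measurable M"
  shows "(\<integral>\<^sup>+ x. f x * g x \<partial>M) \<le> Lnorm p M f * Lnorm q M g"
proof -
  \<comment> \<open>If one norm is 0 and the other \<open>top\<close>, the bound is
    \<open>0 * top = 0\<close>, so the integral itself has to vanish.\<close>
  have *: "(\<integral>\<^sup>+ x. f x * g x \<partial>M) = 0" if "Lnorm p M f = 0 \<or> Lnorm q M g = 0"
  proof -
    have "AE x in M. f x = 0 \<or> g x = 0"
      using that Lnorm_eq_0_AE[of p f M] Lnorm_eq_0_AE[of q g M] pq by auto
    then show ?thesis by (simp add: nn_integral_0_iff_AE)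
  qed
  consider "Lnorm p M f = 0 \<or> Lnorm q M g = 0"
    | "Lnorm p M f \<noteq> 0" "Lnorm q M g \<noteq> 0" "Lnorm p M f = top \<or> Lnorm q M g = top"
    | A B where "0 < A" "Lnorm p M f = ennreal A" "0 < B" "Lnorm q M g = ennreal B"
    by (cases "Lnorm p M f" rule: ennreal_zero_pos_top_cases;
        cases "Lnorm q M g" rule: ennreal_zero_pos_top_cases) auto
  then show ?thesis
  proof cases
    case 1
    then show ?thesis using * by simp
  next
    case 2
    then show ?thesis by (auto simp: ennreal_mult_top ennreal_top_mult)
  next
    case 3
    let ?f = "\<lambda>x. ennreal (1 / A) * f x" and ?g = "\<lambda>x. ennreal (1 / B) * g x"
    have "Lnorm p M ?f = 1" "Lnorm q M ?g = 1"
      using 3 pq by (simp_all add: Lnorm_cmult ennreal_mult[symmetric])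
    then have 1: "(\<integral>\<^sup>+ x. ?f x epowr p \<partial>M) = 1" "(\<integral>\<^sup>+ x. ?g x epowr q \<partial>M) = 1"
      using Lnorm_epowr[of p M ?f] Lnorm_epowr[of q M ?g] pq by simp_all
    have "(\<integral>\<^sup>+ x. ?f x * ?g x \<partial>M)
        \<le> (\<integral>\<^sup>+ x. ennreal (1 / p) * ?f x epowr p + ennreal (1 / q) * ?g x epowr q \<partial>M)"
      by (intro nn_integral_mono ennreal_Young pq)
    also have "\<dots> = ennreal (1 / p) + ennreal (1 / q)"
      by (simp add: nn_integral_add nn_integral_cmult 1)
    also have "\<dots> = 1"
      using pq by (simp add: ennreal_plus[symmetric] del: ennreal_plus)
    finally have le1: "(\<integral>\<^sup>+ x. ?f x * ?g x \<partial>M) \<le> 1" .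
    \<comment> \<open>Undoes the scaling.\<close>
    have AB: "f x * g x = ennreal (A * B) * (?f x * ?g x)" for x
    proof -
      have "ennreal (A * B) * (?f x * ?g x)
          = (ennreal (A * B) * ennreal (1 / A) * ennreal (1 / B)) * (f x * g x)"
        by (simp add: mult_ac)
      also have "ennreal (A * B) * ennreal (1 / A) * ennreal (1 / B) = 1"
        using 3 by (simp add: ennreal_mult[symmetric])
      finally show ?thesis by simp
    qed
    have "(\<integral>\<^sup>+ x. f x * g x \<partial>M) = ennreal (A * B) * (\<integral>\<^sup>+ x. ?f x * ?g x \<partial>M)"
      by (subst AB) (simp add: nn_integral_cmult)
    also have "\<dots> \<le> ennreal (A * B) * 1"
      by (intro mult_left_mono le1) simp
    finally show ?thesis using 3 by (simp add: ennreal_mult)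
  qed
qed

section \<open>Minkowski's integral inequality and the interchange of norms\<close>

text \<open>
  The usual division by the \<open>r\<close>-norm needs that norm to be finite, hence the auxiliary \<open>g\<close> below the
  inner integral; \<open>g\<close> later runs through truncations.
\<close>
lemma Minkowski_integral_aux:
  assumes "sigma_finite_measure M" "sigma_finite_measure N" and r: "r > 1"
    and F [measurable]: "case_prod F \<in> borel_measurable (M \<Otimes>\<^sub>M N)"
    and g [measurable]: "g \<in> borel_measurable N"
    and gle: "\<And>y. g y \<le> (\<integral>\<^sup>+ x. F x y \<partial>M)"
    and fin: "(\<integral>\<^sup>+ y. g y epowr r \<partial>N) \<noteq> top"
  shows "Lnorm r N g \<le> (\<integral>\<^sup>+ x. Lnorm r N (F x) \<partial>M)"
proof -
  interpret M: sigma_finite_measure M by fact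
  interpret N: sigma_finite_measure N by fact
  interpret pair_sigma_finite M N ..
  \<comment> \<open>The exponent conjugate to \<open>r\<close>. Since
    \<open>(r - 1) * r' = r\<close>, the Hoelder factor coming from \<open>g y epowr (r - 1)\<close>
    is a power of \<open>I\<close>.\<close>
  define r' where "r' = r / (r - 1)"
  have r': "r' > 1" "1 / r + 1 / r' = 1" "(r - 1) * r' = r" "1 / r' = 1 - 1 / r"
    using r by (auto simp: r'_def field_simps)
  define I where "I = (\<integral>\<^sup>+ y. g y epowr r \<partial>N)"
  define R where "R = (\<integral>\<^sup>+ x. Lnorm r N (F x) \<partial>M)"
  \<comment> \<open>At 0 and \<open>top\<close> this holds because \<open>r - 1\<close> is
    positive.\<close>
  have split: "a epowr r = a * a epowr (r - 1)" for a
    using r epowr_add[of a 1 "r - 1"]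
    by (cases "a = 0 \<or> a = top") (auto simp: ennreal_mult_top)
  have "I \<le> (\<integral>\<^sup>+ y. (\<integral>\<^sup>+ x. F x y \<partial>M) * g y epowr (r - 1) \<partial>N)"
    unfolding I_def split by (intro nn_integral_mono mult_right_mono gle) simp
  also have "\<dots> = (\<integral>\<^sup>+ y. (\<integral>\<^sup>+ x. F x y * g y epowr (r - 1) \<partial>M) \<partial>N)"
    by (intro nn_integral_cong nn_integral_multc[symmetric]) measurable
  also have "\<dots> = (\<integral>\<^sup>+ x. (\<integral>\<^sup>+ y. F x y * g y epowr (r - 1) \<partial>N) \<partial>M)"
    by (rule Fubini') measurable
  also have "\<dots> \<le> (\<integral>\<^sup>+ x. Lnorm r N (F x) * Lnorm r' N (\<lambda>y. g y epowr (r - 1)) \<partial>M)"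
    by (intro nn_integral_mono nn_integral_Holder r r') measurable
  also have "\<dots> = R * Lnorm r' N (\<lambda>y. g y epowr (r - 1))"
    unfolding R_def by (rule nn_integral_multc) measurable
  also have "Lnorm r' N (\<lambda>y. g y epowr (r - 1)) = I epowr (1 - 1 / r)"
    by (simp add: Lnorm_def epowr_epowr r' I_def)
  finally have I: "I \<le> R * I epowr (1 - 1 / r)" .
  show ?thesis
  proof (cases "I = 0")
    case True
    then show ?thesis using r by (simp add: Lnorm_def I_def)
  next
    case False
    have top: "I \<noteq> top" using fin by (simp add: I_def)
    \<comment> \<open>Dividing by \<open>I epowr (1 - 1 / r)\<close> is expressed as multiplying by
      the opposite power, legitimate as \<open>I\<close> is neither 0 nor
      \<open>top\<close>.\<close>
    have "I epowr (1 / r) = I * I epowr (1 / r - 1)"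
      using epowr_add[OF False top, of 1 "1 / r - 1"] by simp
    also have "\<dots> \<le> R * I epowr (1 - 1 / r) * I epowr (1 / r - 1)"
      by (intro mult_right_mono I) simp
    also have "\<dots> = R"
      using epowr_add[OF False top, of "1 - 1 / r" "1 / r - 1"] by (simp add: mult.assoc)
    finally show ?thesis by (simp add: Lnorm_def I_def R_def)
  qed
qed

text \<open>For \<open>r = 1\<close> this is Tonelli's theorem. For \<open>r > 1\<close> the inner
  integral is exhausted by truncations of finite \<open>r\<close>-norm, and monotone convergence
  passes to the limit.\<close>

lemma Minkowski_integral:
  assumes "sigma_finite_measure M" "sigma_finite_measure N" and "r \<ge> 1"
    and F [measurable]: "case_prod F \<in> borel_measurable (M \<Otimes>\<^sub>M N)"
  shows "Lnorm r N (\<lambda>y. \<integral>\<^sup>+ x. F x y \<partial>M) \<le> (\<integral>\<^sup>+ x. Lnorm r N (F x) \<partial>M)"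
proof -
  interpret M: sigma_finite_measure M by fact
  interpret N: sigma_finite_measure N by fact
  interpret pair_sigma_finite M N ..
  show ?thesis
  proof (cases "r = 1")
    case True
    then show ?thesis by (simp add: Lnorm_def Fubini')
  next
    case False
    with \<open>r \<ge> 1\<close> have r: "r > 1" by simp
    obtain A :: "nat \<Rightarrow> _" where A: "range A \<subseteq> sets N" "(\<Union>i. A i) = space N"
      "\<And>i. emeasure N (A i) \<noteq> \<infinity>" "incseq A"
      using N.sigma_finite_incseq by blast
    have [measurable]: "A n \<in> sets N" for n using A by auto
    define H where "H y = (\<integral>\<^sup>+ x. F x y \<partial>M)" for y
    define R where "R = (\<integral>\<^sup>+ x. Lnorm r N (F x) \<partial>M)"
    \<comment> \<open>Cut off in height at \<open>n\<close> and in space to a set of finite measure,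
      so that the \<open>r\<close>-norm is finite.\<close>
    define g where "g n y = min (H y) (of_nat n) * indicator (A n) y" for n y
    have [measurable]: "H \<in> borel_measurable N" unfolding H_def by measurable
    have [measurable]: "g n \<in> borel_measurable N" for n unfolding g_def by measurable
    have g_bd: "g n y \<le> of_nat n * indicator (A n) y" for n y
      by (auto simp: g_def indicator_def)
    have "(\<integral>\<^sup>+ y. g n y epowr r \<partial>N) \<noteq> top" for n
    proof -
      have "(\<integral>\<^sup>+ y. g n y epowr r \<partial>N) \<le> (\<integral>\<^sup>+ y. of_nat n epowr r * indicator (A n) y \<partial>N)"
        using r by (intro nn_integral_mono order_trans[OF epowr_mono[OF _ g_bd]])
          (auto simp: indicator_def)
      also have "\<dots> = of_nat n epowr r * emeasure N (A n)"
        by (simp add: nn_integral_cmult)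
      also have "\<dots> < top"
        using A(3)[of n] r by (simp add: ennreal_mult_eq_top_iff epowr_eq_top_iff less_top[symmetric])
      finally show ?thesis by simp
    qed
    moreover have "g n y \<le> H y" for n y
      by (auto simp: g_def indicator_def)
    ultimately have "Lnorm r N (g n) \<le> R" for n
      unfolding R_def H_def by (intro Minkowski_integral_aux assms r) auto
    from epowr_mono[OF _ this, of r] have le: "(\<integral>\<^sup>+ y. g n y epowr r \<partial>N) \<le> R epowr r" for n
      using r by (simp add: Lnorm_epowr)
    have g_mono: "g m y \<le> g n y" if "m \<le> n" for m n y
      unfolding g_def using that A(4)
      by (intro mult_mono min.mono) (auto simp: incseq_def indicator_def subset_eq)
    have g_SUP: "(SUP n. g n y) = H y" if "y \<in> space N" for y
    proof -
      obtain k where k: "y \<in> A k" using \<open>y \<in> space N\<close> A(2) by blast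
      have "(SUP n. g n y) = (SUP n. min (H y) (of_nat n))"
      proof (rule antisym)
        show "(SUP n. min (H y) (of_nat n)) \<le> (SUP n. g n y)"
        proof (rule SUP_least)
          fix n :: nat
          \<comment> \<open>The point is only known to lie in \<open>A k\<close>, so height
            \<open>n\<close> is compared with the truncation of index
            \<open>max n k\<close>.\<close>
          have "y \<in> A (max n k)"
            using k incseqD[OF A(4), of k "max n k"] by auto
          then have "min (H y) (of_nat n) \<le> g (max n k) y"
            unfolding g_def by (simp, intro min.coboundedI2 of_nat_mono) simp
          also have "\<dots> \<le> (SUP n. g n y)" by (rule SUP_upper) simp
          finally show "min (H y) (of_nat n) \<le> (SUP n. g n y)" .
        qed
      qed (auto intro!: SUP_mono' simp: g_def indicator_def)
      also have "\<dots> = min (H y) (SUP n. of_nat n)"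
        by (simp add: inf_min[symmetric] inf_SUP)
      finally show ?thesis by (simp add: ennreal_SUP_of_nat_eq_top)
    qed
    have "(\<integral>\<^sup>+ y. H y epowr r \<partial>N) = (\<integral>\<^sup>+ y. (SUP n. g n y epowr r) \<partial>N)"
      using r by (intro nn_integral_cong) (simp add: g_SUP epowr_SUP[symmetric])
    also have "\<dots> = (SUP n. \<integral>\<^sup>+ y. g n y epowr r \<partial>N)"
      using r g_mono
      by (intro nn_integral_monotone_convergence_SUP) (auto simp: incseq_def le_fun_def intro!: epowr_mono)
    also have "\<dots> \<le> R epowr r" by (intro SUP_least le)
    finally have "Lnorm r N H \<le> (R epowr r) epowr (1 / r)"
      unfolding Lnorm_def using r by (intro epowr_mono) auto
    then show ?thesis using r by (simp add: epowr_epowr H_def [abs_def] R_def)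
  qed
qed

text \<open>Minkowski's inequality with exponent \<open>q / p \<ge> 1\<close>, applied to the
  \<open>p\<close>-th power of \<open>F\<close>, followed by a \<open>p\<close>-th root.\<close>

lemma Lnorm_swap_le:
  assumes "sigma_finite_measure M" "sigma_finite_measure N" and pq: "0 < p" "p \<le> q"
    and [measurable]: "case_prod F \<in> borel_measurable (N \<Otimes>\<^sub>M M)"
  shows "Lnorm q N (\<lambda>y. Lnorm p M (F y)) \<le> Lnorm p M (\<lambda>x. Lnorm q N (\<lambda>y. F y x))"
proof -
  interpret M: sigma_finite_measure M by fact
  interpret N: sigma_finite_measure N by fact
  have "Lnorm (q / p) N (\<lambda>y. \<integral>\<^sup>+ x. F y x epowr p \<partial>M)
      \<le> (\<integral>\<^sup>+ x. Lnorm (q / p) N (\<lambda>y. F y x epowr p) \<partial>M)"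
    using pq by (intro Minkowski_integral assms) (auto simp: field_simps)
  then have "Lnorm (q / p) N (\<lambda>y. \<integral>\<^sup>+ x. F y x epowr p \<partial>M) epowr (1 / p)
      \<le> (\<integral>\<^sup>+ x. Lnorm (q / p) N (\<lambda>y. F y x epowr p) \<partial>M) epowr (1 / p)"
    using pq by (intro epowr_mono) auto
  then show ?thesis
    using pq by (simp add: Lnorm_def epowr_epowr)
qed

section \<open>The Schur test for nonnegative functions\<close>

text \<open>The test conditions enter as norm inequalities, with roots already taken. Their
  almost-everywhere quantifiers are iterated with the second variable outside, matching the nesting
  of the norms.\<close>

lemma schur_test_mixed:
  fixes k1 :: "'x \<times> 's \<Rightarrow> ennreal" and k2 :: "'y \<times> 't \<Rightarrow> ennreal"
    and h1 f :: "'s \<times> 't \<Rightarrow> ennreal" and h2 :: "'x \<times> 'y \<Rightarrow> ennreal"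
  assumes "sigma_finite_measure \<mu>1" "sigma_finite_measure \<mu>2"
    "sigma_finite_measure \<nu>1" "sigma_finite_measure \<nu>2"
    and k1 [measurable]: "k1 \<in> borel_measurable (\<nu>1 \<Otimes>\<^sub>M \<mu>1)"
    and k2 [measurable]: "k2 \<in> borel_measurable (\<nu>2 \<Otimes>\<^sub>M \<mu>2)"
    and h1 [measurable]: "h1 \<in> borel_measurable (\<mu>1 \<Otimes>\<^sub>M \<mu>2)"
    and h2 [measurable]: "h2 \<in> borel_measurable (\<nu>1 \<Otimes>\<^sub>M \<nu>2)"
    and f [measurable]: "f \<in> borel_measurable (\<mu>1 \<Otimes>\<^sub>M \<mu>2)"
    and fin: "\<And>z. k1 z \<noteq> top" "\<And>z. k2 z \<noteq> top" "\<And>z. h1 z \<noteq> top"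
    and h1_pos: "\<And>z. z \<in> space (\<mu>1 \<Otimes>\<^sub>M \<mu>2) \<Longrightarrow> h1 z \<noteq> 0"
    and exps: "1 < p1" "1 < p2" "p1 \<le> q1" "p1 \<le> q2" "p2 \<le> q1" "p2 \<le> q2"
    and conj: "1 < p1'" "1 < p2'" "1 / p1 + 1 / p1' = 1" "1 / p2 + 1 / p2' = 1"
    and gd: "\<gamma>1 + \<delta>1 = 1" "\<gamma>2 + \<delta>2 = 1"
    and b1: "AE y in \<nu>2. AE x in \<nu>1.
      Lnorm p2' \<mu>2 (\<lambda>t. Lnorm p1' \<mu>1 (\<lambda>s. k1 (x, s) epowr \<gamma>1 * k2 (y, t) epowr \<gamma>2 * h1 (s, t)))
        \<le> D1 * h2 (x, y)"
    and b2: "AE t in \<mu>2. AE s in \<mu>1.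
      Lnorm q2 \<nu>2 (\<lambda>y. Lnorm q1 \<nu>1 (\<lambda>x. k1 (x, s) epowr \<delta>1 * k2 (y, t) epowr \<delta>2 * h2 (x, y)))
        \<le> D2 * h1 (s, t)"
  shows "Lnorm q2 \<nu>2 (\<lambda>y. Lnorm q1 \<nu>1 (\<lambda>x. \<integral>\<^sup>+ t. \<integral>\<^sup>+ s. k1 (x, s) * k2 (y, t) * f (s, t) \<partial>\<mu>1 \<partial>\<mu>2))
    \<le> D1 * D2 * Lnorm p2 \<mu>2 (\<lambda>t. Lnorm p1 \<mu>1 (\<lambda>s. f (s, t)))"
proof -
  interpret M1: sigma_finite_measure \<mu>1 by fact
  interpret M2: sigma_finite_measure \<mu>2 by fact
  interpret N1: sigma_finite_measure \<nu>1 by fact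
  interpret N2: sigma_finite_measure \<nu>2 by fact
  have pos: "0 < p1" "0 < p2" "0 < q1" "0 < q2" using exps by auto
  define A where "A x y t s = k1 (x, s) epowr \<gamma>1 * k2 (y, t) epowr \<gamma>2 * h1 (s, t)" for x y t s
  define B where "B x y t s = k1 (x, s) epowr \<delta>1 * k2 (y, t) epowr \<delta>2" for x y t s
  define g where "g t s = f (s, t) * inverse (h1 (s, t))" for t s
  \<comment> \<open>The function whose norms are interchanged. The factor \<open>h2 (x, y)\<close>
    from the first test condition is absorbed here, ready for the second.\<close>
  define \<Phi> where "\<Phi> x y t s = h2 (x, y) * (B x y t s * g t s)" for x y t s
  \<comment> \<open>An inequality suffices, and it is trivial where a kernel vanishes; there
    \<open>epowr_add\<close> does not apply.\<close>
  have split: "k1 (x, s) * k2 (y, t) * f (s, t) \<le> A x y t s * (B x y t s * g t s)"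
    if "s \<in> space \<mu>1" "t \<in> space \<mu>2" for x y s t
  proof (cases "k1 (x, s) = 0 \<or> k2 (y, t) = 0")
    case False
    then have 1: "k1 (x, s) = k1 (x, s) epowr \<gamma>1 * k1 (x, s) epowr \<delta>1"
      "k2 (y, t) = k2 (y, t) epowr \<gamma>2 * k2 (y, t) epowr \<delta>2"
      using epowr_add[of "k1 (x, s)" \<gamma>1 \<delta>1] epowr_add[of "k2 (y, t)" \<gamma>2 \<delta>2] fin gd by auto
    have 2: "h1 (s, t) * inverse (h1 (s, t)) = 1"
      using h1_pos[of "(s, t)"] fin(3)[of "(s, t)"] that
      by (auto simp: space_pair_measure less_top divide_ennreal_def[symmetric] intro!: ennreal_divide_self)
    have "A x y t s * (B x y t s * g t s)
        = (k1 (x, s) epowr \<gamma>1 * k1 (x, s) epowr \<delta>1) * (k2 (y, t) epowr \<gamma>2 * k2 (y, t) epowr \<delta>2)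
          * f (s, t) * (h1 (s, t) * inverse (h1 (s, t)))"
      by (simp only: A_def B_def g_def mult_ac)
    then show ?thesis by (simp only: 1[symmetric] 2) simp
  qed auto
  have Holder: "(\<integral>\<^sup>+ t. \<integral>\<^sup>+ s. k1 (x, s) * k2 (y, t) * f (s, t) \<partial>\<mu>1 \<partial>\<mu>2)
      \<le> D1 * Lnorm p2 \<mu>2 (\<lambda>t. Lnorm p1 \<mu>1 (\<lambda>s. \<Phi> x y t s))"
    if [measurable]: "x \<in> space \<nu>1" "y \<in> space \<nu>2"
      and le: "Lnorm p2' \<mu>2 (\<lambda>t. Lnorm p1' \<mu>1 (\<lambda>s. A x y t s)) \<le> D1 * h2 (x, y)" for x y
  proof -
    have [measurable]: "(\<lambda>(t, s). A x y t s) \<in> borel_measurable (\<mu>2 \<Otimes>\<^sub>M \<mu>1)"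
      "(\<lambda>(t, s). B x y t s * g t s) \<in> borel_measurable (\<mu>2 \<Otimes>\<^sub>M \<mu>1)"
      unfolding A_def B_def g_def by measurable
    have "(\<integral>\<^sup>+ t. \<integral>\<^sup>+ s. k1 (x, s) * k2 (y, t) * f (s, t) \<partial>\<mu>1 \<partial>\<mu>2)
        \<le> (\<integral>\<^sup>+ t. \<integral>\<^sup>+ s. A x y t s * (B x y t s * g t s) \<partial>\<mu>1 \<partial>\<mu>2)"
      by (intro nn_integral_mono split)
    also have "\<dots> \<le> (\<integral>\<^sup>+ t. Lnorm p1' \<mu>1 (\<lambda>s. A x y t s) * Lnorm p1 \<mu>1 (\<lambda>s. B x y t s * g t s) \<partial>\<mu>2)"
      using conj exps by (intro nn_integral_mono nn_integral_Holder) (auto simp: add.commute)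
    also have "\<dots> \<le> Lnorm p2' \<mu>2 (\<lambda>t. Lnorm p1' \<mu>1 (\<lambda>s. A x y t s))
        * Lnorm p2 \<mu>2 (\<lambda>t. Lnorm p1 \<mu>1 (\<lambda>s. B x y t s * g t s))"
      using conj exps by (intro nn_integral_Holder) (auto simp: add.commute)
    also have "\<dots> \<le> D1 * h2 (x, y) * Lnorm p2 \<mu>2 (\<lambda>t. Lnorm p1 \<mu>1 (\<lambda>s. B x y t s * g t s))"
      by (intro mult_right_mono le) simp
    \<comment> \<open>\<open>h2 (x, y)\<close> is constant in \<open>s\<close> and \<open>t\<close>,
      so it moves inside both norms.\<close>
    also have "\<dots> = D1 * Lnorm p2 \<mu>2 (\<lambda>t. Lnorm p1 \<mu>1 (\<lambda>s. \<Phi> x y t s))"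
      unfolding \<Phi>_def using pos by (simp add: Lnorm_cmult mult.assoc cong: Lnorm_cong)
    finally show ?thesis .
  qed
  \<comment> \<open>Arbitrary measurable substitutions are allowed because every interchange below
    orders the four variables differently.\<close>
  have [measurable]: "(\<lambda>w. \<Phi> (a w) (b w) (c w) (d w)) \<in> borel_measurable L"
    if [measurable]: "a \<in> L \<rightarrow>\<^sub>M \<nu>1" "b \<in> L \<rightarrow>\<^sub>M \<nu>2" "c \<in> L \<rightarrow>\<^sub>M \<mu>2" "d \<in> L \<rightarrow>\<^sub>M \<mu>1"
    for a b c d and L :: "'l measure"
    unfolding \<Phi>_def B_def g_def by measurable
  have "Lnorm q2 \<nu>2 (\<lambda>y. Lnorm q1 \<nu>1 (\<lambda>x. \<integral>\<^sup>+ t. \<integral>\<^sup>+ s. k1 (x, s) * k2 (y, t) * f (s, t) \<partial>\<mu>1 \<partial>\<mu>2))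
      \<le> Lnorm q2 \<nu>2 (\<lambda>y. Lnorm q1 \<nu>1 (\<lambda>x. D1 * Lnorm p2 \<mu>2 (\<lambda>t. Lnorm p1 \<mu>1 (\<lambda>s. \<Phi> x y t s))))"
  proof (rule Lnorm_mono_AE[OF pos(4)])
    show "AE y in \<nu>2. Lnorm q1 \<nu>1 (\<lambda>x. \<integral>\<^sup>+ t. \<integral>\<^sup>+ s. k1 (x, s) * k2 (y, t) * f (s, t) \<partial>\<mu>1 \<partial>\<mu>2)
        \<le> Lnorm q1 \<nu>1 (\<lambda>x. D1 * Lnorm p2 \<mu>2 (\<lambda>t. Lnorm p1 \<mu>1 (\<lambda>s. \<Phi> x y t s)))"
      using b1 AE_space
    proof eventually_elim
      case (elim y)
      show ?case
        using elim(1) AE_space[of \<nu>1] elim(2)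
        by (intro Lnorm_mono_AE pos) (auto simp: A_def[symmetric] intro: Holder elim!: eventually_elim2)
    qed
  qed
  also have "\<dots> = D1 * Lnorm q2 \<nu>2 (\<lambda>y. Lnorm q1 \<nu>1 (\<lambda>x. Lnorm p2 \<mu>2 (\<lambda>t. Lnorm p1 \<mu>1 (\<lambda>s. \<Phi> x y t s))))"
    using pos by (simp add: Lnorm_cmult cong: Lnorm_cong)
  also have "\<dots> \<le> D1 * (D2 * Lnorm p2 \<mu>2 (\<lambda>t. Lnorm p1 \<mu>1 (\<lambda>s. f (s, t))))"
  proof (rule mult_left_mono)
    \<comment> \<open>The norms pass each other in the order \<open>q1\<close> and
      \<open>p2\<close>, \<open>q1\<close> and \<open>p1\<close>, \<open>q2\<close> and
      \<open>p2\<close>, \<open>q2\<close> and \<open>p1\<close>; each exchange uses one of the four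
      inequalities between exponents.\<close>
    have "Lnorm q2 \<nu>2 (\<lambda>y. Lnorm q1 \<nu>1 (\<lambda>x. Lnorm p2 \<mu>2 (\<lambda>t. Lnorm p1 \<mu>1 (\<lambda>s. \<Phi> x y t s))))
        \<le> Lnorm q2 \<nu>2 (\<lambda>y. Lnorm p2 \<mu>2 (\<lambda>t. Lnorm q1 \<nu>1 (\<lambda>x. Lnorm p1 \<mu>1 (\<lambda>s. \<Phi> x y t s))))"
      by (intro Lnorm_mono Lnorm_swap_le pos exps assms(1-4)) measurable
    also have "\<dots> \<le> Lnorm q2 \<nu>2 (\<lambda>y. Lnorm p2 \<mu>2 (\<lambda>t. Lnorm p1 \<mu>1 (\<lambda>s. Lnorm q1 \<nu>1 (\<lambda>x. \<Phi> x y t s))))"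
      by (intro Lnorm_mono Lnorm_swap_le pos exps assms(1-4)) measurable
    also have "\<dots> \<le> Lnorm p2 \<mu>2 (\<lambda>t. Lnorm q2 \<nu>2 (\<lambda>y. Lnorm p1 \<mu>1 (\<lambda>s. Lnorm q1 \<nu>1 (\<lambda>x. \<Phi> x y t s))))"
      by (intro Lnorm_swap_le pos exps assms(1-4)) measurable
    also have "\<dots> \<le> Lnorm p2 \<mu>2 (\<lambda>t. Lnorm p1 \<mu>1 (\<lambda>s. Lnorm q2 \<nu>2 (\<lambda>y. Lnorm q1 \<nu>1 (\<lambda>x. \<Phi> x y t s))))"
      by (intro Lnorm_mono Lnorm_swap_le pos exps assms(1-4)) measurable
    also have "\<dots> \<le> Lnorm p2 \<mu>2 (\<lambda>t. Lnorm p1 \<mu>1 (\<lambda>s. D2 * f (s, t)))"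
    proof (rule Lnorm_mono_AE[OF pos(2)])
      \<comment> \<open>\<open>g t s\<close> is constant in \<open>x\<close> and \<open>y\<close>;
        once it is pulled out, its factor \<open>inverse (h1 (s, t))\<close> cancels the
        \<open>h1\<close> of the second test condition.\<close>
      have *: "Lnorm q2 \<nu>2 (\<lambda>y. Lnorm q1 \<nu>1 (\<lambda>x. \<Phi> x y t s)) \<le> D2 * f (s, t)"
        if st [measurable]: "s \<in> space \<mu>1" "t \<in> space \<mu>2"
          and le: "Lnorm q2 \<nu>2 (\<lambda>y. Lnorm q1 \<nu>1 (\<lambda>x. k1 (x, s) epowr \<delta>1 * k2 (y, t) epowr \<delta>2 * h2 (x, y)))
            \<le> D2 * h1 (s, t)" for s t
      proof -
        have "Lnorm q2 \<nu>2 (\<lambda>y. Lnorm q1 \<nu>1 (\<lambda>x. \<Phi> x y t s))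
            = Lnorm q2 \<nu>2 (\<lambda>y. Lnorm q1 \<nu>1 (\<lambda>x. g t s * (k1 (x, s) epowr \<delta>1 * k2 (y, t) epowr \<delta>2 * h2 (x, y))))"
          by (simp add: \<Phi>_def B_def mult_ac)
        also have "\<dots> = g t s * Lnorm q2 \<nu>2 (\<lambda>y. Lnorm q1 \<nu>1 (\<lambda>x. k1 (x, s) epowr \<delta>1 * k2 (y, t) epowr \<delta>2 * h2 (x, y)))"
          using pos by (simp add: Lnorm_cmult cong: Lnorm_cong)
        also have "\<dots> \<le> g t s * (D2 * h1 (s, t))"
          by (intro mult_left_mono le) simp
        also have "\<dots> = D2 * f (s, t) * (h1 (s, t) * inverse (h1 (s, t)))"
          by (simp add: g_def mult_ac)
        also have "h1 (s, t) * inverse (h1 (s, t)) = 1"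
          using h1_pos[of "(s, t)"] fin(3)[of "(s, t)"] st
          by (auto simp: space_pair_measure less_top divide_ennreal_def[symmetric] intro!: ennreal_divide_self)
        finally show ?thesis by simp
      qed
      show "AE t in \<mu>2. Lnorm p1 \<mu>1 (\<lambda>s. Lnorm q2 \<nu>2 (\<lambda>y. Lnorm q1 \<nu>1 (\<lambda>x. \<Phi> x y t s)))
          \<le> Lnorm p1 \<mu>1 (\<lambda>s. D2 * f (s, t))"
        using b2 AE_space
      proof eventually_elim
        case (elim t)
        show ?case
          using elim(1) AE_space[of \<mu>1] elim(2)
          by (intro Lnorm_mono_AE pos) (auto intro: * elim!: eventually_elim2)
      qed
    qed
    also have "\<dots> = D2 * Lnorm p2 \<mu>2 (\<lambda>t. Lnorm p1 \<mu>1 (\<lambda>s. f (s, t)))"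
      using pos by (simp add: Lnorm_cmult cong: Lnorm_cong)
    finally show "Lnorm q2 \<nu>2 (\<lambda>y. Lnorm q1 \<nu>1 (\<lambda>x. Lnorm p2 \<mu>2 (\<lambda>t. Lnorm p1 \<mu>1 (\<lambda>s. \<Phi> x y t s))))
        \<le> D2 * Lnorm p2 \<mu>2 (\<lambda>t. Lnorm p1 \<mu>1 (\<lambda>s. f (s, t)))" .
  qed simp
  finally show ?thesis by (simp add: mult.assoc)
qed

section \<open>From nonnegative functions to the complex integral operator\<close>

text \<open>Integrability is not assumed: otherwise the Bochner integral is 0 and the bound is
  trivial.\<close>

lemma ennreal_norm_integral_le:
  fixes f :: "'a \<Rightarrow> 'b::{banach, second_countable_topology}"
  shows "ennreal (norm (integral\<^sup>L M f)) \<le> (\<integral>\<^sup>+ x. ennreal (norm (f x)) \<partial>M)"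
  by (cases "integrable M f") (simp_all add: integral_norm_bound_ennreal not_integrable_integral_eq)

text \<open>Swapping the coordinates reduces this to \<open>AE_pair\<close>. The second variable
  must be outermost because mixed norms integrate over it last.\<close>

lemma (in pair_sigma_finite) AE_pair_snd:
  assumes "AE z in M1 \<Otimes>\<^sub>M M2. P z"
  shows "AE y in M2. AE x in M1. P (x, y)"
proof -
  interpret Q: pair_sigma_finite M2 M1 ..
  have "AE z in M2 \<Otimes>\<^sub>M M1. P (case z of (x, y) \<Rightarrow> (y, x))"
    using assms by (subst (asm) distr_pair_swap) (rule AE_distrD[OF measurable_pair_swap'])
  from Q.AE_pair[OF this] show ?thesis by simp
qed

lemma mixed_norm_eq_Lnorm:
  assumes "p1 > 0"
  shows "mixed_norm p1 p2 \<mu>1 \<mu>2 f = Lnorm p2 \<mu>2 (\<lambda>t. Lnorm p1 \<mu>1 (\<lambda>s. ennreal (norm (f (s, t)))))"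
  by (simp add: mixed_norm_def Lnorm_def epowr_epowr)

theorem proposition3p1:
  fixes X :: "'a measure"
    and \<mu>1 \<mu>2 \<nu>1 \<nu>2 :: "'a measure"
    and K1 K2 h1 h2 :: "'a \<times> 'a \<Rightarrow> real"
    and p1 p2 q1 q2 p1' p2' \<gamma>1 \<gamma>2 \<delta>1 \<delta>2 C1 C2 :: real
  assumes "sets \<mu>1 = sets X" "sets \<mu>2 = sets X" "sets \<nu>1 = sets X" "sets \<nu>2 = sets X"
    and "sigma_finite_measure \<mu>1" "sigma_finite_measure \<mu>2"
    and "sigma_finite_measure \<nu>1" "sigma_finite_measure \<nu>2"
    and "K1 \<in> borel_measurable (X \<Otimes>\<^sub>M X)" "K2 \<in> borel_measurable (X \<Otimes>\<^sub>M X)"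
    and "\<forall>z \<in> space (X \<Otimes>\<^sub>M X). 0 \<le> K1 z" "\<forall>z \<in> space (X \<Otimes>\<^sub>M X). 0 \<le> K2 z"
    and "1 < p1" "1 < p2" "1 < q1" "1 < q2"
    and "1 < min p1 p2" "min p1 p2 \<le> max p1 p2" "max p1 p2 \<le> min q1 q2"
    and "1 / p1 + 1 / p1' = 1" "1 / p2 + 1 / p2' = 1"
    and "\<gamma>1 + \<delta>1 = 1" "\<gamma>2 + \<delta>2 = 1"
    and "h1 \<in> borel_measurable (X \<Otimes>\<^sub>M X)" "h2 \<in> borel_measurable (X \<Otimes>\<^sub>M X)"
    and "\<forall>z \<in> space (X \<Otimes>\<^sub>M X). 0 < h1 z" "\<forall>z \<in> space (X \<Otimes>\<^sub>M X). 0 < h2 z"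
    and "0 < C1" "0 < C2"
    and "AE (x, y) in \<nu>1 \<Otimes>\<^sub>M \<nu>2.
           (\<integral>\<^sup>+ t. (\<integral>\<^sup>+ s. ennreal (K1 (x, s)) epowr (\<gamma>1 * p1') * ennreal (K2 (y, t)) epowr (\<gamma>2 * p1')
                        * ennreal (h1 (s, t)) epowr p1' \<partial>\<mu>1) epowr (p2' / p1') \<partial>\<mu>2)
             \<le> ennreal C1 * ennreal (h2 (x, y)) epowr p2'"
    and "AE (s, t) in \<mu>1 \<Otimes>\<^sub>M \<mu>2.
           (\<integral>\<^sup>+ y. (\<integral>\<^sup>+ x. ennreal (K1 (x, s)) epowr (\<delta>1 * q1) * ennreal (K2 (y, t)) epowr (\<delta>2 * q1)
                        * ennreal (h2 (x, y)) epowr q1 \<partial>\<nu>1) epowr (q2 / q1) \<partial>\<nu>2)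
             \<le> ennreal C2 * ennreal (h1 (s, t)) epowr q2"
  shows "(\<forall>f \<in> mixed_Lp p1 p2 \<mu>1 \<mu>2.
            AE z in \<nu>1 \<Otimes>\<^sub>M \<nu>2. product_kernel_converges K1 K2 \<mu>1 \<mu>2 f z)
       \<and> bounded_mixed_op p1 p2 \<mu>1 \<mu>2 q1 q2 \<nu>1 \<nu>2 (product_kernel_op K1 K2 \<mu>1 \<mu>2)
       \<and> mixed_opnorm p1 p2 \<mu>1 \<mu>2 q1 q2 \<nu>1 \<nu>2 (product_kernel_op K1 K2 \<mu>1 \<mu>2)
           \<le> ennreal (C1 powr (1 / p2') * C2 powr (1 / q2))"
proof -
  note sets_eq [measurable_cong] = assms(1-4)
  have space_eq: "space \<mu>1 = space X" "space \<mu>2 = space X" "space \<nu>1 = space X" "space \<nu>2 = space X"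
    using sets_eq by (auto dest: sets_eq_imp_space_eq)
  interpret M1: sigma_finite_measure \<mu>1 by fact
  interpret M2: sigma_finite_measure \<mu>2 by fact
  interpret N1: sigma_finite_measure \<nu>1 by fact
  interpret N2: sigma_finite_measure \<nu>2 by fact
  interpret M: pair_sigma_finite \<mu>1 \<mu>2 ..
  interpret N: pair_sigma_finite \<nu>1 \<nu>2 ..
  note [measurable] = assms(9,10,24,25)
  have K_nonneg: "0 \<le> K1 (x, s)" "0 \<le> K2 (x, s)" if "x \<in> space X" "s \<in> space X" for x s
    using assms(11,12) that by (auto simp: space_pair_measure)
  have h_pos: "0 < h1 (x, s)" "0 < h2 (x, s)" if "x \<in> space X" "s \<in> space X" for x s
    using assms(26,27) that by (auto simp: space_pair_measure)
  \<comment> \<open>The reciprocal of \<open>p'\<close> lies strictly between 0 and 1, which also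
    rules out \<open>p' = 0\<close>, where \<open>1 / p' = 0\<close>.\<close>
  have conj_gt: "1 < p'" if "1 < p" "1 / p + 1 / p' = 1" for p p' :: real
  proof -
    have "0 < 1 / p" "1 / p < 1" using that(1) by auto
    then have "0 < 1 / p'" "1 / p' < 1" using that(2) by linarith+
    then show ?thesis by (simp add: field_simps split: if_splits)
  qed
  have p1': "1 < p1'" and p2': "1 < p2'"
    using conj_gt assms(13,14,20,21) by auto
  have pq: "0 < p1" "0 < p2" "0 < q1" "0 < q2" "p1 \<le> q1" "p1 \<le> q2" "p2 \<le> q1" "p2 \<le> q2"
    using assms(13-19) by auto
  define D1 where "D1 = C1 powr (1 / p2')"
  define D2 where "D2 = C2 powr (1 / q2)"
  \<comment> \<open>Taking the \<open>p2'\<close>-th root turns the hypothesis into a norm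
    inequality: \<open>epowr_mult\<close> and \<open>epowr_epowr\<close> distribute the exponent
    \<open>p1'\<close> over the three factors.\<close>
  have b1: "AE y in \<nu>2. AE x in \<nu>1.
      Lnorm p2' \<mu>2 (\<lambda>t. Lnorm p1' \<mu>1 (\<lambda>s. ennreal (K1 (x, s)) epowr \<gamma>1 * ennreal (K2 (y, t)) epowr \<gamma>2
          * ennreal (h1 (s, t)))) \<le> ennreal D1 * ennreal (h2 (x, y))"
    using N.AE_pair_snd[OF assms(30)]
  proof (elim eventually_mono, goal_cases)
    case (1 y x)
    then have "(\<integral>\<^sup>+ t. (\<integral>\<^sup>+ s. ennreal (K1 (x, s)) epowr (\<gamma>1 * p1') * ennreal (K2 (y, t)) epowr (\<gamma>2 * p1')
        * ennreal (h1 (s, t)) epowr p1' \<partial>\<mu>1) epowr (p2' / p1') \<partial>\<mu>2) epowr (1 / p2')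
        \<le> (ennreal C1 * ennreal (h2 (x, y)) epowr p2') epowr (1 / p2')"
      using p2' by (intro epowr_mono) auto
    then show ?case
      using p1' p2' assms(28) by (simp add: Lnorm_def epowr_mult epowr_epowr D1_def ennreal_epowr)
  qed
  have b2: "AE t in \<mu>2. AE s in \<mu>1.
      Lnorm q2 \<nu>2 (\<lambda>y. Lnorm q1 \<nu>1 (\<lambda>x. ennreal (K1 (x, s)) epowr \<delta>1 * ennreal (K2 (y, t)) epowr \<delta>2
          * ennreal (h2 (x, y)))) \<le> ennreal D2 * ennreal (h1 (s, t))"
    using M.AE_pair_snd[OF assms(31)]
  proof (elim eventually_mono, goal_cases)
    case (1 t s)
    then have "(\<integral>\<^sup>+ y. (\<integral>\<^sup>+ x. ennreal (K1 (x, s)) epowr (\<delta>1 * q1) * ennreal (K2 (y, t)) epowr (\<delta>2 * q1)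
        * ennreal (h2 (x, y)) epowr q1 \<partial>\<nu>1) epowr (q2 / q1) \<partial>\<nu>2) epowr (1 / q2)
        \<le> (ennreal C2 * ennreal (h1 (s, t)) epowr q2) epowr (1 / q2)"
      using pq by (intro epowr_mono) auto
    then show ?case
      using pq assms(29) by (simp add: Lnorm_def epowr_mult epowr_epowr D2_def ennreal_epowr)
  qed
  \<comment> \<open>The integral with absolute values inside. It dominates the operator, and its
    finiteness is absolute convergence.\<close>
  define A where "A f x y = (\<integral>\<^sup>+ t. \<integral>\<^sup>+ s. ennreal (K1 (x, s)) * ennreal (K2 (y, t)) * ennreal (norm (f (s, t))) \<partial>\<mu>1 \<partial>\<mu>2)"
    for f :: "'a \<times> 'a \<Rightarrow> complex" and x y
  let ?T = "product_kernel_op K1 K2 \<mu>1 \<mu>2"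
  let ?Lp = "mixed_Lp p1 p2 \<mu>1 \<mu>2"
  have meas: "f \<in> borel_measurable (\<mu>1 \<Otimes>\<^sub>M \<mu>2)" if "f \<in> ?Lp" for f
    using that by (simp add: mixed_Lp_def)
  have A_meas [measurable]: "(\<lambda>z. A f (fst z) (snd z)) \<in> borel_measurable (\<nu>1 \<Otimes>\<^sub>M \<nu>2)"
    if [measurable]: "f \<in> borel_measurable (\<mu>1 \<Otimes>\<^sub>M \<mu>2)" for f
    unfolding A_def by measurable
  have A_bound: "Lnorm q2 \<nu>2 (\<lambda>y. Lnorm q1 \<nu>1 (\<lambda>x. A f x y)) \<le> ennreal (D1 * D2) * mixed_norm p1 p2 \<mu>1 \<mu>2 f"
    if "f \<in> ?Lp" for f
  proof -
    note [measurable] = meas[OF that]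
    have "Lnorm q2 \<nu>2 (\<lambda>y. Lnorm q1 \<nu>1 (\<lambda>x. A f x y))
        \<le> ennreal D1 * ennreal D2 * Lnorm p2 \<mu>2 (\<lambda>t. Lnorm p1 \<mu>1 (\<lambda>s. ennreal (norm (f (s, t)))))"
      unfolding A_def
      by (rule schur_test_mixed[where ?k1.0 = "\<lambda>z. ennreal (K1 z)" and ?k2.0 = "\<lambda>z. ennreal (K2 z)"
            and f = "\<lambda>z. ennreal (norm (f z))" and ?h1.0 = "\<lambda>z. ennreal (h1 z)" and ?h2.0 = "\<lambda>z. ennreal (h2 z)",
            OF assms(5-8) _ _ _ _ _ _ _ _ _ assms(13,14) pq(5-8) p1' p2' assms(20-23) b1 b2])
         (auto simp: space_pair_measure space_eq dest: h_pos)
    then show ?thesis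
      using pq by (simp add: mixed_norm_eq_Lnorm ennreal_mult D1_def D2_def)
  qed
  \<comment> \<open>Holds at every point, including those of divergence, where default values of the
    Bochner integral only lower the left side.\<close>
  have T_le: "ennreal (norm (?T f (x, y))) \<le> A f x y" if "x \<in> space \<nu>1" "y \<in> space \<nu>2" for f x y
  proof -
    have "ennreal (norm (?T f (x, y)))
        \<le> (\<integral>\<^sup>+ t. \<integral>\<^sup>+ s. ennreal (norm (complex_of_real (K1 (x, s) * K2 (y, t)) * f (s, t))) \<partial>\<mu>1 \<partial>\<mu>2)"
      unfolding product_kernel_op_def prod.case
      by (rule order_trans[OF ennreal_norm_integral_le]) (intro nn_integral_mono ennreal_norm_integral_le)
    also have "\<dots> = A f x y"
      unfolding A_def using that K_nonneg
      by (intro nn_integral_cong) (simp add: norm_mult ennreal_mult space_eq)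
    finally show ?thesis .
  qed
  have T_bound: "mixed_norm q1 q2 \<nu>1 \<nu>2 (?T f) \<le> ennreal (D1 * D2) * mixed_norm p1 p2 \<mu>1 \<mu>2 f"
    if "f \<in> ?Lp" for f
  proof -
    have "mixed_norm q1 q2 \<nu>1 \<nu>2 (?T f) \<le> Lnorm q2 \<nu>2 (\<lambda>y. Lnorm q1 \<nu>1 (\<lambda>x. A f x y))"
      using pq by (simp add: mixed_norm_eq_Lnorm Lnorm_mono T_le)
    with A_bound[OF that] show ?thesis by simp
  qed
  have T_Lp: "?T f \<in> mixed_Lp q1 q2 \<nu>1 \<nu>2" if "f \<in> ?Lp" for f
  proof -
    note [measurable] = meas[OF that]
    have "?T f \<in> borel_measurable (\<nu>1 \<Otimes>\<^sub>M \<nu>2)"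
      unfolding product_kernel_op_def by measurable
    moreover have "ennreal (D1 * D2) * mixed_norm p1 p2 \<mu>1 \<mu>2 f < top"
      using that by (auto simp: mixed_Lp_def ennreal_mult_less_top)
    ultimately show ?thesis
      using T_bound[OF that] by (auto simp: mixed_Lp_def)
  qed
  \<comment> \<open>Finiteness of the iterated norm of \<open>A f\<close> yields finiteness almost
    everywhere one variable at a time.\<close>
  have conv: "AE z in \<nu>1 \<Otimes>\<^sub>M \<nu>2. product_kernel_converges K1 K2 \<mu>1 \<mu>2 f z" if "f \<in> ?Lp" for f
  proof -
    note [measurable] = meas[OF that]
    have "Lnorm q2 \<nu>2 (\<lambda>y. Lnorm q1 \<nu>1 (\<lambda>x. A f x y)) < top"
      using A_bound[OF that] that by (auto simp: mixed_Lp_def ennreal_mult_less_top intro: order.strict_trans1)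
    then have "AE y in \<nu>2. Lnorm q1 \<nu>1 (\<lambda>x. A f x y) \<noteq> top"
      using pq by (intro Lnorm_finite_AE[of q2]) (auto simp: A_def)
    then have "AE y in \<nu>2. AE x in \<nu>1. A f x y \<noteq> top"
      using AE_space
    proof eventually_elim
      case (elim y)
      have "(\<lambda>x. A f x y) \<in> borel_measurable \<nu>1"
        using measurable_compose[OF measurable_Pair2'[OF elim(2)] A_meas[OF meas[OF that]]] by simp
      then show ?case
        using pq elim(1) by (intro Lnorm_finite_AE[of q1])
    qed
    \<comment> \<open>The quantifiers are exchanged and then merged into one over the product
      measure, which uses joint measurability of \<open>A f\<close>.\<close>
    then have "AE z in \<nu>1 \<Otimes>\<^sub>M \<nu>2. A f (fst z) (snd z) \<noteq> top"
      by (subst (asm) N.AE_commute[symmetric]) (auto intro: N.AE_pair_measure)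
    then show ?thesis
      using AE_space
    proof eventually_elim
      case (elim z)
      obtain x y where z: "z = (x, y)" "x \<in> space \<nu>1" "y \<in> space \<nu>2"
        using elim(2) by (auto simp: space_pair_measure)
      have [measurable]: "x \<in> space X" "y \<in> space X"
        using z by (simp_all add: space_eq)
      define k where "k = (\<lambda>(s, t). complex_of_real (K1 (x, s) * K2 (y, t)) * f (s, t))"
      have [measurable]: "k \<in> borel_measurable (\<mu>1 \<Otimes>\<^sub>M \<mu>2)"
        unfolding k_def by measurable
      have "(\<integral>\<^sup>+ w. ennreal (norm (k w)) \<partial>(\<mu>1 \<Otimes>\<^sub>M \<mu>2)) = (\<integral>\<^sup>+ t. \<integral>\<^sup>+ s. ennreal (norm (k (s, t))) \<partial>\<mu>1 \<partial>\<mu>2)"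
        by (rule M.nn_integral_snd[symmetric]) measurable
      also have "\<dots> = A f x y"
        unfolding A_def k_def using z K_nonneg
        by (intro nn_integral_cong) (simp add: norm_mult ennreal_mult space_eq)
      finally have "integrable (\<mu>1 \<Otimes>\<^sub>M \<mu>2) k"
        using elim(1) z(1) by (simp add: integrable_iff_bounded less_top)
      then show ?case
        by (simp add: product_kernel_converges_def k_def z(1))
    qed
  qed
  \<comment> \<open>At points of absolute convergence Fubini replaces the iterated integral by one
    over the product, where additivity needs only integrability.\<close>
  have T_eq: "?T f (x, y) = (\<integral>(s, t). complex_of_real (K1 (x, s) * K2 (y, t)) * f (s, t) \<partial>(\<mu>1 \<Otimes>\<^sub>M \<mu>2))"
    if "product_kernel_converges K1 K2 \<mu>1 \<mu>2 f (x, y)" for f x y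
    using M.integral_snd[of "\<lambda>s t. complex_of_real (K1 (x, s) * K2 (y, t)) * f (s, t)"] that
    by (simp add: product_kernel_op_def product_kernel_converges_def)
  \<comment> \<open>Where the integrals for \<open>f\<close> and \<open>g\<close> both converge
    absolutely, so does the one for the sum; no triangle inequality for mixed norms enters.\<close>
  have T_add: "AE z in \<nu>1 \<Otimes>\<^sub>M \<nu>2. ?T (\<lambda>w. f w + g w) z = ?T f z + ?T g z"
    if "f \<in> ?Lp" "g \<in> ?Lp" for f g
    using conv[OF that(1)] conv[OF that(2)]
  proof eventually_elim
    case (elim z)
    obtain x y where z: "z = (x, y)" by (cases z)
    let ?k = "\<lambda>f (s, t). complex_of_real (K1 (x, s) * K2 (y, t)) * f (s, t)"
    have fg: "?k (\<lambda>w. f w + g w) = (\<lambda>w. ?k f w + ?k g w)"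
      by (auto simp: algebra_simps)
    have int: "integrable (\<mu>1 \<Otimes>\<^sub>M \<mu>2) (?k f)" "integrable (\<mu>1 \<Otimes>\<^sub>M \<mu>2) (?k g)"
      using elim by (simp_all add: z product_kernel_converges_def)
    then have "integrable (\<mu>1 \<Otimes>\<^sub>M \<mu>2) (?k (\<lambda>w. f w + g w))"
      unfolding fg by (rule Bochner_Integration.integrable_add)
    then have "?T (\<lambda>w. f w + g w) z = integral\<^sup>L (\<mu>1 \<Otimes>\<^sub>M \<mu>2) (?k (\<lambda>w. f w + g w))"
      unfolding z by (intro T_eq) (simp add: product_kernel_converges_def)
    also have "\<dots> = ?T f z + ?T g z"
      unfolding fg Bochner_Integration.integral_add[OF int] using elim by (simp add: z T_eq)
    finally show ?case .
  qed
  \<comment> \<open>Exact at every point: scalars leave the Bochner integral even without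
    integrability.\<close>
  have T_scale: "?T (\<lambda>w. c * f w) z = c * ?T f z" for f c z
    by (cases z) (simp add: product_kernel_op_def mult.left_commute[of _ c])
  have "mixed_opnorm p1 p2 \<mu>1 \<mu>2 q1 q2 \<nu>1 \<nu>2 ?T \<le> ennreal (D1 * D2)"
    unfolding mixed_opnorm_def
  proof (rule SUP_least, clarify)
    fix f assume f: "f \<in> ?Lp" "mixed_norm p1 p2 \<mu>1 \<mu>2 f \<le> 1"
    show "mixed_norm q1 q2 \<nu>1 \<nu>2 (?T f) \<le> ennreal (D1 * D2)"
      using T_bound[OF f(1)] mult_left_mono[OF f(2), of "ennreal (D1 * D2)"] by simp
  qed
  moreover have "bounded_mixed_op p1 p2 \<mu>1 \<mu>2 q1 q2 \<nu>1 \<nu>2 ?T"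
    unfolding bounded_mixed_op_def
    by (intro conjI exI[of _ "D1 * D2"] ballI allI T_Lp T_add T_bound) (simp_all add: T_scale)
  ultimately show ?thesis
    using conv by (simp add: D1_def D2_def)
qed

end
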